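(* Let $(X,\|\cdot\|)$ be a cylindrical normed space. (i) If $(G,p)$ is a well-positioned and minimally infinitesimally rigid bar-joint framework in $(X,\|\cdot\|)$, then either $G=K_6-e$ or $|V(G)|\ge 7$. (ii) There is a placement $p$ of $K_6-e$ in $X$ so that $(K_6-e,p)$ is well-positioned and minimally infinitesimally rigid in $(X,\|\cdot\|)$.
   Context: A cylindrical normed space is a normed linear space isometrically isomorphic to $(\mathbb{R}^3,\|\cdot\|_{\mathrm{cyl}})$, where $\|(x,y,z)\|_{\mathrm{cyl}}=\max\{\sqrt{x^2+y^2},|z|\}$. $K_6-e$ is the complete graph $K_6$ on $6$ vertices with a single edge $e$ removed. Frameworks. $G=(V,E)$ is a finite simple graph, and $V(G)=V$ denotes its vertex set. A bar-joint framework $(G,p)$ in $X$ is $G$ with a map (placement) $p:V\to X$, $v\mapsto p_v$, such that $p_v\ne p_w$ for all $vw\in E$. A support functional for a unit vector $x_0\in X$ is a linear functional $f:X\to\mathbb{R}$ with $\|f\|\le1$ and $f(x_0)=1$; the norm is smooth at $x\neq0$ if $x/\|x\|$ has exactly one support functional. $(G,p)$ is well-positioned if the norm is smooth at $p_v-p_w$ for every $vw\in E$. A rigid motion of $(X,\|\cdot\|)$ is a family of continuous paths $\{\alpha_x:[-1,1]\to X\}_{x\in X}$ with $\alpha_x(0)=x$, $\alpha_x$ differentiable at $0$, and $\|\alpha_x(t)-\alpha_y(t)\|=\|x-y\|$ for all $x,y\in X$, $t\in[-1,1]$. $\mathcal{T}(X,\|\cdot\|)$ is the space of maps $\eta:X\to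 X$ of the form $\eta(x)=\alpha_x'(0)$ for a rigid motion $\alpha$. With $f_G:X^V\to\mathbb{R}^E$, $f_G((x_v)_v)=(\|x_v-x_w\|)_{vw\in E}$, an infinitesimal flex of $(G,p)$ is $z\in X^V$ with $\lim_{t\to0}\frac1t(f_G(p+tz)-f_G(p))=0$; it is trivial if $z=\eta\circ p$ for some $\eta\in\mathcal{T}(X,\|\cdot\|)$. $(G,p)$ is infinitesimally rigid if every infinitesimal flex is trivial, infinitesimally flexible otherwise, and minimally infinitesimally rigid if it is infinitesimally rigid and every subframework obtained by removing an edge from $G$ (keeping all vertices) is infinitesimally flexible.
   Formalization: Part (i) is stated for graphs with at least two vertices: the empty graph and the single-vertex graph have no edges and are vacuously well-positioned and minimally infinitesimally rigid, so the claim fails for exactly these two. *)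

theory Defs
  imports "HOL-Analysis.Analysis"
begin

subsection \<open>Cylindrical normed spaces\<close>

definition cyl_norm :: "real ^ 3 \<Rightarrow> real" where
  "cyl_norm a = max (sqrt ((a $ 1)\<^sup>2 + (a $ 2)\<^sup>2)) \<bar>a $ 3\<bar>"

text \<open>The space \<open>X\<close> is a type of class \<^class>\<open>real_normed_vector\<close>, its norm is \<^const>\<open>norm\<close>. The type
  \<^typ>\<open>real ^ 3\<close> only serves as the vector space \<open>\<real>\<^sup>3\<close>; its own Euclidean norm is not used.\<close>

definition cylindrical_normed_space :: "'x::real_normed_vector itself \<Rightarrow> bool" where
  "cylindrical_normed_space _ \<longleftrightarrow>
     (\<exists>T :: 'x \<Rightarrow> real ^ 3. linear T \<and> bij T \<and> (\<forall>x. cyl_norm (T x) = norm x))"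


subsection \<open>Smoothness of the norm\<close>

definition support_functional :: "'x::real_normed_vector \<Rightarrow> ('x \<Rightarrow> real) \<Rightarrow> bool" where
  "support_functional x0 f \<longleftrightarrow> bounded_linear f \<and> onorm f \<le> 1 \<and> f x0 = 1"

definition norm_smooth_at :: "'x::real_normed_vector \<Rightarrow> bool" where
  "norm_smooth_at x \<longleftrightarrow> x \<noteq> 0 \<and> (\<exists>!f. support_functional (x /\<^sub>R norm x) f)"


subsection \<open>Graphs and frameworks\<close>

text \<open>A graph is given by its vertex set \<open>V\<close> and its set \<open>E\<close> of edges, which are two-element
  subsets of \<open>V\<close>. Points of \<open>X\<^sup>V\<close> are total functions; only their values on \<open>V\<close> are used.\<close>

definition complete_edges :: "'v set \<Rightarrow> 'v set set" where
  "complete_edges V = {e. e \<subseteq> V \<and> card e = 2}"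

definition finite_simple_graph :: "'v set \<Rightarrow> 'v set set \<Rightarrow> bool" where
  "finite_simple_graph V E \<longleftrightarrow> finite V \<and> E \<subseteq> complete_edges V"

text \<open>The graphs isomorphic to \<open>K\<^sub>6 - e\<close>.\<close>

definition K6_minus_edge :: "'v set \<Rightarrow> 'v set set \<Rightarrow> bool" where
  "K6_minus_edge V E \<longleftrightarrow>
     finite V \<and> card V = 6 \<and> (\<exists>e \<in> complete_edges V. E = complete_edges V - {e})"

definition framework :: "'v set \<Rightarrow> 'v set set \<Rightarrow> ('v \<Rightarrow> 'x::real_normed_vector) \<Rightarrow> bool" where
  "framework V E p \<longleftrightarrow> finite_simple_graph V E \<and> (\<forall>v w. {v, w} \<in> E \<longrightarrow> p v \<noteq> p w)"

definition well_positioned :: "'v set set \<Rightarrow> ('v \<Rightarrow> 'x::real_normed_vector) \<Rightarrow> bool" where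
  "well_positioned E p \<longleftrightarrow> (\<forall>v w. {v, w} \<in> E \<longrightarrow> norm_smooth_at (p v - p w))"


subsection \<open>Rigid motions and infinitesimal rigidity\<close>

text \<open>Paths are parametrised by \<open>[-1, 1]\<close>; values of \<open>\<alpha> x\<close> outside this interval are unconstrained,
  and do not affect the derivative at the interior point \<open>0\<close>.\<close>

definition rigid_motion :: "('x::real_normed_vector \<Rightarrow> real \<Rightarrow> 'x) \<Rightarrow> bool" where
  "rigid_motion \<alpha> \<longleftrightarrow>
     (\<forall>x. continuous_on {-1..1} (\<alpha> x) \<and> \<alpha> x 0 = x \<and> \<alpha> x differentiable at 0) \<and>
     (\<forall>x y. \<forall>t \<in> {-1..1}. norm (\<alpha> x t - \<alpha> y t) = norm (x - y))"

definition infinitesimal_rigid_motions :: "('x::real_normed_vector \<Rightarrow> 'x) set" where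
  "infinitesimal_rigid_motions =
     {\<eta>. \<exists>\<alpha>. rigid_motion \<alpha> \<and> (\<forall>x. (\<alpha> x has_vector_derivative \<eta> x) (at 0))}"

text \<open>The limit of \<open>(f\<^sub>G(p + t z) - f\<^sub>G(p)) / t\<close> in the finite-dimensional space \<open>\<real>\<^sup>E\<close> is taken
  coordinatewise, one coordinate for each edge; it does not depend on the order of the endpoints.\<close>

definition infinitesimal_flex ::
    "'v set set \<Rightarrow> ('v \<Rightarrow> 'x::real_normed_vector) \<Rightarrow> ('v \<Rightarrow> 'x) \<Rightarrow> bool" where
  "infinitesimal_flex E p z \<longleftrightarrow>
     (\<forall>v w. {v, w} \<in> E \<longrightarrow>
        ((\<lambda>t::real. (norm ((p v + t *\<^sub>R z v) - (p w + t *\<^sub>R z w)) - norm (p v - p w)) / t)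
           \<longlongrightarrow> 0) (at 0))"

definition trivial_flex :: "'v set \<Rightarrow> ('v \<Rightarrow> 'x::real_normed_vector) \<Rightarrow> ('v \<Rightarrow> 'x) \<Rightarrow> bool" where
  "trivial_flex V p z \<longleftrightarrow> (\<exists>\<eta> \<in> infinitesimal_rigid_motions. \<forall>v \<in> V. z v = \<eta> (p v))"

definition infinitesimally_rigid ::
    "'v set \<Rightarrow> 'v set set \<Rightarrow> ('v \<Rightarrow> 'x::real_normed_vector) \<Rightarrow> bool" where
  "infinitesimally_rigid V E p \<longleftrightarrow> (\<forall>z. infinitesimal_flex E p z \<longrightarrow> trivial_flex V p z)"

definition minimally_infinitesimally_rigid ::
    "'v set \<Rightarrow> 'v set set \<Rightarrow> ('v \<Rightarrow> 'x::real_normed_vector) \<Rightarrow> bool" where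
  "minimally_infinitesimally_rigid V E p \<longleftrightarrow>
     infinitesimally_rigid V E p \<and> (\<forall>e \<in> E. \<not> infinitesimally_rigid V (E - {e}) p)"

end

theory Submission
  imports Defs
begin

text \<open>
  Idea. In cylindrical coordinates the norm is differentiable away from the cone
  \<open>x\<^sup>2 + y\<^sup>2 = z\<^sup>2\<close> and, inside and outside this cone, depends only on \<open>z\<close> or only on \<open>(x, y)\<close>. So each
  edge of a well-positioned framework imposes on an infinitesimal flex one linear equation of one of two
  kinds: equality of two heights, or the planar Euclidean bar equation for the horizontal parts.
  Being well-positioned is exactly the absence of edges on the cone (\<open>norm_smooth_at_iff\<close>).

  A rigid motion need not be affine by definition, but its velocity field satisfies the
  linearised distance equations for all pairs of points off the cone. Testing against a few
  well-chosen points forces it to be a rotation about the vertical axis plus a translation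
  (\<open>infinitesimal_isometry_form\<close>). Trivial flexes thus have the four parameters \<open>c\<close> and \<open>b\<close> in
  \<open>c *\<^sub>R quarter_turn a + b\<close>; they are independent unless all joints lie on one
  vertical line, in which case a horizontal push of a single joint is a nontrivial flex.

  Fixing four suitable coordinates of the flex to be zero removes the trivial flexes, so rigidity
  says that \<open>card E\<close> linear equations in \<open>3 * card V - 4\<close> unknowns have only the zero solution.
  Fewer equations than unknowns are too few; more equations than unknowns are linearly dependent, and an
  edge with a nonzero coefficient in a dependency can be removed without losing rigidity. Hence minimal
  rigidity gives \<open>card E = 3 * card V - 4\<close> (\<open>minimally_cyl_rigid_card\<close>). A graph with
  \<open>2 \<le> card V \<le> 5\<close> does not have that many edges, and with six vertices this number is \<open>14\<close>, one less than in
  the complete graph.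

  Conversely a placement of \<open>K\<^sub>6 - e\<close> is minimally rigid as soon as it is rigid, because
  removing any of the \<open>14\<close> edges leaves too few equations. A well-positioned rigid placement must split the edges
  into a spanning tree of steep edges, which ties the heights together, and nine flat
  edges forming a rigid planar framework. The placement in \<open>zigzag_placement\<close> uses a
  Hamiltonian path as the tree; the missing edge closes it to a hexagon, whose complement, the
  triangular prism, is generically rigid in the plane.
\<close>

section \<open>The cylindrical norm and its derivative\<close>

definition off_cone :: "real ^ 3 \<Rightarrow> bool" where
  "off_cone d \<longleftrightarrow> (d $ 1)\<^sup>2 + (d $ 2)\<^sup>2 \<noteq> (d $ 3)\<^sup>2"

text \<open>Off the cone, this is the derivative of the norm at \<open>d\<close> in direction \<open>u\<close>, multiplied by
  \<open>cyl_norm d\<close>. The scaling makes it polynomial in \<open>d\<close> on each side of the cone and preserves the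
  zeros, which is all that flexes depend on. The test is on squares so that concrete
  placements need no square roots.\<close>

definition edge_form :: "real ^ 3 \<Rightarrow> real ^ 3 \<Rightarrow> real" where
  "edge_form d u = (if (d $ 3)\<^sup>2 < (d $ 1)\<^sup>2 + (d $ 2)\<^sup>2
     then d $ 1 * u $ 1 + d $ 2 * u $ 2 else d $ 3 * u $ 3)"

text \<open>The velocity field of the rotations about the vertical axis at unit speed.\<close>

definition quarter_turn :: "real ^ 3 \<Rightarrow> real ^ 3" where
  "quarter_turn a = vector [- (a $ 2), a $ 1, 0]"

lemma quarter_turn_nth [simp]:
  "quarter_turn a $ 1 = - (a $ 2)" "quarter_turn a $ 2 = a $ 1" "quarter_turn a $ 3 = 0"
  by (simp_all add: quarter_turn_def)

lemma linear_quarter_turn: "linear quarter_turn"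
  by (rule linearI) (simp_all add: vec_eq_iff forall_3)

lemma linear_edge_form: "linear (edge_form d)"
  by (rule linearI) (simp_all add: edge_form_def algebra_simps)

lemma edge_form_minus: "edge_form (- d) (- u) = edge_form d u"
  by (simp add: edge_form_def)

lemma edge_form_quarter_turn: "edge_form d (quarter_turn d) = 0"
  by (simp add: edge_form_def)

lemma cyl_norm_eq: "cyl_norm a = sqrt (max ((a $ 1)\<^sup>2 + (a $ 2)\<^sup>2) ((a $ 3)\<^sup>2))"
  unfolding cyl_norm_def using real_sqrt_le_iff by (auto simp: max_def simp flip: real_sqrt_abs)

text \<open>Near \<open>d\<close> one of the two arguments of the maximum stays strictly larger, so the norm coincides there
  with the root of one quadratic form. Writing \<open>\<bar>z\<bar>\<close> as \<open>sqrt (z\<^sup>2)\<close> treats both sides of the cone alike.\<close>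

lemma cyl_norm_has_derivative:
  assumes "off_cone d"
  shows "(cyl_norm has_derivative (\<lambda>u. edge_form d u / cyl_norm d)) (at d)"
proof (cases "(d $ 3)\<^sup>2 < (d $ 1)\<^sup>2 + (d $ 2)\<^sup>2")
  case True
  let ?S = "{a :: real ^ 3. (a $ 3)\<^sup>2 < (a $ 1)\<^sup>2 + (a $ 2)\<^sup>2}"
  have "open ?S"
    by (intro open_Collect_less continuous_intros)
  moreover have "((\<lambda>a :: real ^ 3. sqrt ((a $ 1)\<^sup>2 + (a $ 2)\<^sup>2)) has_derivative
      (\<lambda>u. edge_form d u / cyl_norm d)) (at d)"
  proof -
    have "0 < (d $ 1)\<^sup>2 + (d $ 2)\<^sup>2"
      using True zero_le_power2[of "d $ 3"] by linarith
    then show ?thesis using True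
      by (auto intro!: derivative_eq_intros bounded_linear.has_derivative[OF bounded_linear_vec_nth]
          simp: fun_eq_iff edge_form_def cyl_norm_eq max_def field_simps)
        (simp add: add_divide_distrib mult.commute)
  qed
  ultimately show ?thesis
    using True by (elim has_derivative_transform_within_open[rotated]) (auto simp: cyl_norm_eq max_def)
next
  case False
  then have less: "(d $ 1)\<^sup>2 + (d $ 2)\<^sup>2 < (d $ 3)\<^sup>2"
    using assms by (simp add: off_cone_def)
  let ?S = "{a :: real ^ 3. (a $ 1)\<^sup>2 + (a $ 2)\<^sup>2 < (a $ 3)\<^sup>2}"
  have "open ?S"
    by (intro open_Collect_less continuous_intros)
  moreover have "((\<lambda>a :: real ^ 3. sqrt ((a $ 3)\<^sup>2)) has_derivative
      (\<lambda>u. edge_form d u / cyl_norm d)) (at d)"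
  proof -
    have "0 < (d $ 3)\<^sup>2"
      using less by (smt (verit) zero_le_power2)
    then show ?thesis using less
      by (auto intro!: derivative_eq_intros bounded_linear.has_derivative[OF bounded_linear_vec_nth]
          simp: fun_eq_iff edge_form_def cyl_norm_eq max_def field_simps simp del: real_sqrt_abs)
  qed
  ultimately show ?thesis
    using less by (elim has_derivative_transform_within_open[rotated]) (auto simp: cyl_norm_eq max_def)
qed

lemma cyl_norm_curve_derivative:
  assumes "(\<gamma> has_vector_derivative u) (at 0)" and "off_cone (\<gamma> 0)"
  shows "((\<lambda>t. cyl_norm (\<gamma> t)) has_real_derivative edge_form (\<gamma> 0) u / cyl_norm (\<gamma> 0)) (at 0)"
proof -
  have "((\<lambda>t. cyl_norm (\<gamma> t)) has_derivative (\<lambda>t. edge_form (\<gamma> 0) (t *\<^sub>R u) / cyl_norm (\<gamma> 0))) (at 0)"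
    using has_derivative_compose[of \<gamma> "\<lambda>t. t *\<^sub>R u" 0 UNIV, OF _ cyl_norm_has_derivative[OF assms(2)]] assms(1)
    by (simp add: has_vector_derivative_def)
  then show ?thesis
    unfolding has_field_derivative_def
    by (rule has_derivative_eq_rhs)
      (simp add: fun_eq_iff linear_cmul[OF linear_edge_form])
qed

section \<open>Homogeneous linear systems\<close>

text \<open>Gaussian elimination: an equation with a nonzero coefficient at \<open>k\<close> expresses the unknown \<open>k\<close>
  through the others, and substituting it leaves one equation and one unknown fewer. Stating
  this over arbitrary finite index sets lets the rigidity matrix serve both as a system on flexes
  and, transposed, as a system on edge weights.\<close>

lemma homogeneous_system_nontrivial_solution:
  fixes A :: "'j \<Rightarrow> 'i \<Rightarrow> 'a :: field"
  assumes "finite J" "finite I" "card J < card I"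
  shows "\<exists>x. (\<exists>i\<in>I. x i \<noteq> 0) \<and> (\<forall>j\<in>J. (\<Sum>i\<in>I. x i * A j i) = 0)"
  using assms
proof (induction J arbitrary: I A rule: finite_induct)
  case empty
  then obtain i where "i \<in> I" by fastforce
  then show ?case by (intro exI[of _ "\<lambda>_. 1"]) auto
next
  case (insert j J)
  show ?case
  proof (cases "\<forall>i\<in>I. A j i = 0")
    case True
    obtain x where x: "\<exists>i\<in>I. x i \<noteq> 0" "\<forall>j\<in>J. (\<Sum>i\<in>I. x i * A j i) = 0"
      using insert.IH[of I A] insert.prems insert.hyps by auto
    have "(\<Sum>i\<in>I. x i * A j i) = 0"
      using True by simp
    then show ?thesis
      using x by (intro exI[of _ x]) auto
  next
    case False
    then obtain k where k: "k \<in> I" "A j k \<noteq> 0" by auto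
    define B where "B j' i = A j' i - A j i / A j k * A j' k" for j' i
    have "card J < card (I - {k})"
      using insert.prems insert.hyps k by simp
    then obtain x where x: "\<exists>i\<in>I-{k}. x i \<noteq> 0" "\<forall>j'\<in>J. (\<Sum>i\<in>I-{k}. x i * B j' i) = 0"
      using insert.IH[of "I - {k}" B] insert.prems by auto
    define s where "s = (\<Sum>i\<in>I-{k}. x i * A j i)"
    define y where "y = x(k := - s / A j k)"
    have sum: "(\<Sum>i\<in>I. y i * A j' i) = (\<Sum>i\<in>I-{k}. x i * A j' i) - s / A j k * A j' k" for j'
    proof -
      have "(\<Sum>i\<in>I. y i * A j' i) = y k * A j' k + (\<Sum>i\<in>I-{k}. y i * A j' i)"
        using insert.prems k by (intro sum.remove)
      also have "(\<Sum>i\<in>I-{k}. y i * A j' i) = (\<Sum>i\<in>I-{k}. x i * A j' i)"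
        by (intro sum.cong) (auto simp: y_def)
      finally show ?thesis by (simp add: y_def)
    qed
    have "(\<Sum>i\<in>I. y i * A j i) = 0"
      using k by (simp add: sum) (simp add: s_def)
    moreover have "(\<Sum>i\<in>I. y i * A j' i) = 0" if "j' \<in> J" for j'
    proof -
      have "0 = (\<Sum>i\<in>I-{k}. x i * B j' i)" using x that by simp
      also have "\<dots> = (\<Sum>i\<in>I-{k}. x i * A j' i) - s / A j k * A j' k"
      proof -
        have "s / A j k * A j' k = (\<Sum>i\<in>I-{k}. x i * (A j i / A j k * A j' k))"
          unfolding s_def sum_divide_distrib sum_distrib_right by (simp add: mult.assoc)
        then show ?thesis
          by (simp add: B_def sum_subtractf right_diff_distrib)
      qed
      finally show ?thesis by (simp add: sum)
    qed
    moreover have "\<exists>i\<in>I. y i \<noteq> 0"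
      using x by (auto simp: y_def)
    ultimately show ?thesis by (intro exI[of _ y]) auto
  qed
qed

section \<open>The edge count of minimally rigid frameworks\<close>

definition cyl_flex :: "'v set set \<Rightarrow> ('v \<Rightarrow> real ^ 3) \<Rightarrow> ('v \<Rightarrow> real ^ 3) \<Rightarrow> bool" where
  "cyl_flex E q y \<longleftrightarrow> (\<forall>v w. {v, w} \<in> E \<longrightarrow> edge_form (q v - q w) (y v - y w) = 0)"

definition cyl_trivial :: "'v set \<Rightarrow> ('v \<Rightarrow> real ^ 3) \<Rightarrow> ('v \<Rightarrow> real ^ 3) \<Rightarrow> bool" where
  "cyl_trivial V q y \<longleftrightarrow> (\<exists>c b. \<forall>v\<in>V. y v = c *\<^sub>R quarter_turn (q v) + b)"

definition cyl_rigid :: "'v set \<Rightarrow> 'v set set \<Rightarrow> ('v \<Rightarrow> real ^ 3) \<Rightarrow> bool" where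
  "cyl_rigid V E q \<longleftrightarrow> (\<forall>y. cyl_flex E q y \<longrightarrow> cyl_trivial V q y)"

definition unit_flex :: "'v \<times> 3 \<Rightarrow> 'v \<Rightarrow> real ^ 3" where
  "unit_flex i v = (if v = fst i then axis (snd i) 1 else 0)"

lemma sum_unit_flex_nth:
  assumes "finite I"
  shows "(\<Sum>i\<in>I. x i *\<^sub>R unit_flex i v) $ k = (if (v, k) \<in> I then x (v, k) else 0)"
proof -
  have "(\<Sum>i\<in>I. x i *\<^sub>R unit_flex i v) $ k = (\<Sum>i\<in>I. if i = (v, k) then x i else 0)"
    unfolding sum_component by (intro sum.cong) (auto simp: unit_flex_def axis_def)
  then show ?thesis
    using assms by (simp add: sum.delta)
qed

lemma edge_form_diff_sum:
  "edge_form d ((\<Sum>i\<in>I. x i *\<^sub>R unit_flex i v) - (\<Sum>i\<in>I. x i *\<^sub>R unit_flex i w)) =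
    (\<Sum>i\<in>I. x i * edge_form d (unit_flex i v - unit_flex i w))"
proof -
  have "(\<Sum>i\<in>I. x i *\<^sub>R unit_flex i v) - (\<Sum>i\<in>I. x i *\<^sub>R unit_flex i w) =
      (\<Sum>i\<in>I. x i *\<^sub>R (unit_flex i v - unit_flex i w))"
    by (simp add: sum_subtractf scaleR_diff_right)
  then show ?thesis
    by (simp add: linear_sum[OF linear_edge_form] linear_cmul[OF linear_edge_form])
qed

text \<open>Edges are unordered, so the rows of the rigidity matrix need a choice of endpoints.\<close>

lemma complete_edges_ends:
  assumes "E \<subseteq> complete_edges V"
  obtains s t where "\<And>e. e \<in> E \<Longrightarrow> e = {s e, t e}"
proof -
  have "\<forall>e\<in>E. \<exists>st. e = {fst st, snd st}"
    using assms by (force simp: complete_edges_def card_2_iff)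
  then obtain st where "\<forall>e\<in>E. e = {fst (st e), snd (st e)}"
    by metis
  then show ?thesis
    using that[of "fst \<circ> st" "snd \<circ> st"] by simp
qed

text \<open>The choice of endpoints is harmless because \<^const>\<open>edge_form\<close> does not change when both
  of its arguments change sign.\<close>

lemma cyl_flex_ends:
  assumes "\<And>e. e \<in> E \<Longrightarrow> e = {s e, t e}"
  shows "cyl_flex E q y \<longleftrightarrow> (\<forall>e\<in>E. edge_form (q (s e) - q (t e)) (y (s e) - y (t e)) = 0)"
proof
  assume "cyl_flex E q y"
  then show "\<forall>e\<in>E. edge_form (q (s e) - q (t e)) (y (s e) - y (t e)) = 0"
    using assms by (metis cyl_flex_def)
next
  assume R: "\<forall>e\<in>E. edge_form (q (s e) - q (t e)) (y (s e) - y (t e)) = 0"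
  show "cyl_flex E q y"
    unfolding cyl_flex_def
  proof (intro allI impI)
    fix v w assume vw: "{v, w} \<in> E"
    define a b where "a = s {v, w}" and "b = t {v, w}"
    have "{v, w} = {a, b}"
      using assms[OF vw] by (simp add: a_def b_def)
    then consider "v = a" "w = b" | "v = b" "w = a"
      by (auto simp: doubleton_eq_iff)
    moreover have "edge_form (q a - q b) (y a - y b) = 0"
      using R vw by (simp add: a_def b_def)
    ultimately show "edge_form (q v - q w) (y v - y w) = 0"
      using edge_form_minus[of "q a - q b" "y a - y b"] by cases simp_all
  qed
qed

text \<open>Trivial flexes are factored out by choosing a complement of coordinate form: pin all three
  coordinates of the flex at \<open>v0\<close>, which excludes translations, and one coordinate \<open>k\<close> at a joint \<open>v1\<close>
  where the rotation about \<open>v0\<close> has a nonzero \<open>k\<close>-th component, which excludes rotations. The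
  remaining \<open>3 * card V - 4\<close> coordinates are the unknowns.\<close>

locale pinned_placement =
  fixes V :: "'v set" and E :: "'v set set" and q :: "'v \<Rightarrow> real ^ 3" and v0 v1 :: 'v and k :: 3
  assumes finite_V: "finite V" and E: "E \<subseteq> complete_edges V"
    and v0: "v0 \<in> V" and v1: "v1 \<in> V"
    and k: "quarter_turn (q v1) $ k \<noteq> quarter_turn (q v0) $ k"
begin

definition free_coords :: "('v \<times> 3) set" where
  "free_coords = (V - {v0}) \<times> UNIV - {(v1, k)}"

definition pinned :: "('v \<Rightarrow> real ^ 3) \<Rightarrow> bool" where
  "pinned y \<longleftrightarrow> y v0 = 0 \<and> y v1 $ k = 0"

lemma finite_free_coords: "finite free_coords"
  using finite_V by (simp add: free_coords_def)

lemma finite_E: "finite E"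
  by (rule finite_subset[of _ "Pow V"]) (use E finite_V in \<open>auto simp: complete_edges_def\<close>)

lemma card_free_coords: "card free_coords + 4 = 3 * card V"
proof -
  have "v1 \<noteq> v0" using k by auto
  have "{v0, v1} \<subseteq> V" using v0 v1 by simp
  then have "card V \<ge> 2"
    using card_mono[OF finite_V, of "{v0, v1}"] \<open>v1 \<noteq> v0\<close> by simp
  moreover have "(v1, k) \<in> (V - {v0}) \<times> UNIV"
    using v1 \<open>v1 \<noteq> v0\<close> by simp
  ultimately show ?thesis
    using v0 finite_V by (simp add: free_coords_def card_cartesian_product)
qed

lemma pinned_expand:
  assumes "pinned y" "v \<in> V"
  shows "y v = (\<Sum>i\<in>free_coords. (y (fst i) $ snd i) *\<^sub>R unit_flex i v)"
proof -
  have "y v $ l = (if (v, l) \<in> free_coords then y v $ l else 0)" for l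
    using assms by (auto simp: free_coords_def pinned_def)
  then show ?thesis
    unfolding vec_eq_iff sum_unit_flex_nth[OF finite_free_coords] by (metis fst_conv snd_conv)
qed

lemma pinned_trivial_zero:
  assumes "pinned y" "cyl_trivial V q y" "v \<in> V"
  shows "y v = 0"
proof -
  obtain c b where cb: "\<And>v. v \<in> V \<Longrightarrow> y v = c *\<^sub>R quarter_turn (q v) + b"
    using assms(2) by (auto simp: cyl_trivial_def)
  have b: "b = - c *\<^sub>R quarter_turn (q v0)"
    using cb[OF v0] assms(1) by (simp add: pinned_def eq_neg_iff_add_eq_0 add.commute)
  have "0 = y v1 $ k"
    using assms(1) by (simp add: pinned_def)
  also have "\<dots> = c * (quarter_turn (q v1) $ k - quarter_turn (q v0) $ k)"
    by (simp add: cb[OF v1] b algebra_simps)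
  finally have "c = 0"
    using k by simp
  then show ?thesis
    using cb[OF assms(3)] b by simp
qed

text \<open>Pinned flexes meet every class modulo trivial flexes.\<close>

lemma pin:
  obtains c b where "pinned (\<lambda>v. y v - (c *\<^sub>R quarter_turn (q v) + b))"
proof -
  define c where "c = (y v1 $ k - y v0 $ k) / (quarter_turn (q v1) $ k - quarter_turn (q v0) $ k)"
  have "c * (quarter_turn (q v1) $ k - quarter_turn (q v0) $ k) = y v1 $ k - y v0 $ k"
    using k by (simp add: c_def)
  then show ?thesis
    by (intro that[of c "y v0 - c *\<^sub>R quarter_turn (q v0)"]) (simp add: pinned_def algebra_simps)
qed

text \<open>With fewer edges than free coordinates, some nonzero pinned flex satisfies all edge equations,
  and it cannot be trivial.\<close>

lemma cyl_rigid_card_lower: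
  assumes "cyl_rigid V E q"
  shows "3 * card V \<le> card E + 4"
proof (rule ccontr)
  assume "\<not> ?thesis"
  then have less: "card E < card free_coords"
    using card_free_coords by linarith
  obtain s t where st: "\<And>e. e \<in> E \<Longrightarrow> e = {s e, t e}"
    using complete_edges_ends[OF E] by blast
  obtain x where x: "\<exists>i\<in>free_coords. x i \<noteq> 0"
    "\<forall>e\<in>E. (\<Sum>i\<in>free_coords. x i *
       edge_form (q (s e) - q (t e)) (unit_flex i (s e) - unit_flex i (t e))) = 0"
    using homogeneous_system_nontrivial_solution[OF finite_E finite_free_coords less,
        of "\<lambda>e i. edge_form (q (s e) - q (t e)) (unit_flex i (s e) - unit_flex i (t e))"] by blast
  define y where "y v = (\<Sum>i\<in>free_coords. x i *\<^sub>R unit_flex i v)" for v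
  have "cyl_flex E q y"
    using x(2) cyl_flex_ends[of E s t q y] st by (simp add: y_def edge_form_diff_sum)
  then have "cyl_trivial V q y"
    using assms by (simp add: cyl_rigid_def)
  moreover have y_nth: "y v $ l = (if (v, l) \<in> free_coords then x (v, l) else 0)" for v l
    by (simp add: y_def sum_unit_flex_nth finite_free_coords del: sum_component)
  have "pinned y"
    by (auto simp: pinned_def vec_eq_iff y_nth free_coords_def)
  ultimately have zero: "y v = 0" if "v \<in> V" for v
    using pinned_trivial_zero that by blast
  obtain v l where vl: "(v, l) \<in> free_coords" "x (v, l) \<noteq> 0"
    using x(1) by auto
  then have "v \<in> V" by (simp add: free_coords_def)
  then show False
    using zero[of v] vl y_nth[of v l] by simp
qed

text \<open>With more edges than free coordinates, the rows restricted to pinned flexes are linearly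
  dependent. Rows vanish on trivial flexes, so the dependency \<open>\<mu>\<close> holds on all flexes, and an edge of
  nonzero weight has its equation implied by the other edges.\<close>

lemma redundant_edge:
  assumes "3 * card V < card E + 4"
  obtains e where "e \<in> E" "\<And>y. cyl_flex (E - {e}) q y \<Longrightarrow> cyl_flex E q y"
proof -
  have less: "card free_coords < card E"
    using card_free_coords assms by linarith
  obtain s t where st: "\<And>e. e \<in> E \<Longrightarrow> e = {s e, t e}"
    using complete_edges_ends[OF E] by blast
  define row where "row e y = edge_form (q (s e) - q (t e)) (y (s e) - y (t e))" for e y
  obtain \<mu> where \<mu>: "\<exists>e\<in>E. \<mu> e \<noteq> 0"
    "\<forall>i\<in>free_coords. (\<Sum>e\<in>E. \<mu> e * row e (unit_flex i)) = 0"
    using homogeneous_system_nontrivial_solution[OF finite_free_coords finite_E less,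
        of "\<lambda>i e. row e (unit_flex i)"] by blast
  have row_pinned: "(\<Sum>e\<in>E. \<mu> e * row e y) = 0" if y: "pinned y" for y
  proof -
    let ?x = "\<lambda>i. y (fst i) $ snd i"
    have "row e y = (\<Sum>i\<in>free_coords. ?x i * row e (unit_flex i))" if "e \<in> E" for e
    proof -
      have "e \<subseteq> V" using E that by (auto simp: complete_edges_def)
      then have "s e \<in> V" "t e \<in> V" using st[OF that] by auto
      then show ?thesis
        unfolding row_def edge_form_diff_sum[symmetric]
        by (intro arg_cong2[where f = "\<lambda>a b. edge_form (q (s e) - q (t e)) (a - b)"] pinned_expand[OF y])
    qed
    then have "(\<Sum>e\<in>E. \<mu> e * row e y) = (\<Sum>e\<in>E. \<Sum>i\<in>free_coords. ?x i * (\<mu> e * row e (unit_flex i)))"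
      by (simp add: sum_distrib_left mult.left_commute)
    also have "\<dots> = (\<Sum>i\<in>free_coords. ?x i * (\<Sum>e\<in>E. \<mu> e * row e (unit_flex i)))"
      by (subst sum.swap) (simp add: sum_distrib_left)
    also have "\<dots> = 0" using \<mu> by simp
    finally show ?thesis .
  qed
  have row_all: "(\<Sum>e\<in>E. \<mu> e * row e y) = 0" for y
  proof -
    obtain c b where cb: "pinned (\<lambda>v. y v - (c *\<^sub>R quarter_turn (q v) + b))"
      by (rule pin)
    have "row e (\<lambda>v. y v - (c *\<^sub>R quarter_turn (q v) + b)) = row e y" for e
    proof -
      let ?d = "q (s e) - q (t e)"
      have eq: "(y (s e) - (c *\<^sub>R quarter_turn (q (s e)) + b)) - (y (t e) - (c *\<^sub>R quarter_turn (q (t e)) + b))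
          = (y (s e) - y (t e)) - c *\<^sub>R quarter_turn ?d"
        by (simp add: linear_diff[OF linear_quarter_turn] algebra_simps)
      show ?thesis
        unfolding row_def eq linear_diff[OF linear_edge_form] linear_cmul[OF linear_edge_form]
          edge_form_quarter_turn by simp
    qed
    then show ?thesis using row_pinned[OF cb] by simp
  qed
  obtain e where e: "e \<in> E" "\<mu> e \<noteq> 0" using \<mu>(1) by blast
  show ?thesis
  proof (rule that[OF e(1)])
    fix y assume "cyl_flex (E - {e}) q y"
    then have other: "row e' y = 0" if "e' \<in> E - {e}" for e'
      using cyl_flex_ends[of "E - {e}" s t q y] st that by (simp add: row_def)
    have "0 = (\<Sum>e'\<in>E. \<mu> e' * row e' y)" using row_all by simp
    also have "\<dots> = \<mu> e * row e y + (\<Sum>e'\<in>E - {e}. \<mu> e' * row e' y)"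
      using finite_E e by (intro sum.remove)
    also have "\<dots> = \<mu> e * row e y" using other by simp
    finally have "row e y = 0" using e by simp
    then have "row e' y = 0" if "e' \<in> E" for e'
      using other that by (cases "e' = e") auto
    then show "cyl_flex E q y"
      using cyl_flex_ends[of E s t q y] st by (simp add: row_def)
  qed
qed

end

text \<open>If all joints lie on one vertical line, every edge is vertical and constrains only heights.
  Then pushing a single joint horizontally is a flex, while trivial flexes move all
  joints with the same velocity. So rigidity provides the joints needed for pinning.\<close>

lemma cyl_rigid_imp_turn_differs:
  assumes "cyl_rigid V E q" and "2 \<le> card V" and E: "E \<subseteq> complete_edges V"
  obtains v0 v1 k where "v0 \<in> V" "v1 \<in> V" "quarter_turn (q v1) $ k \<noteq> quarter_turn (q v0) $ k"
proof -
  have "\<exists>v0\<in>V. \<exists>v1\<in>V. quarter_turn (q v1) \<noteq> quarter_turn (q v0)"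
  proof (rule ccontr)
    assume "\<not> ?thesis"
    then have same: "\<And>v w. v \<in> V \<Longrightarrow> w \<in> V \<Longrightarrow> quarter_turn (q v) = quarter_turn (q w)"
      by blast
    obtain v0 where v0: "v0 \<in> V" using assms(2) by fastforce
    have "V - {v0} \<noteq> {}"
      using assms(2) card_mono[of "{v0}" V] by force
    then obtain v1 where v1: "v1 \<in> V" "v1 \<noteq> v0" by blast
    let ?y = "unit_flex (v0, 1)"
    have "edge_form (q v - q w) (?y v - ?y w) = 0" if "{v, w} \<in> E" for v w
    proof -
      have "v \<in> V" "w \<in> V" using E that by (auto simp: complete_edges_def)
      then have "q v $ 1 = q w $ 1" "q v $ 2 = q w $ 2"
        using same[of v w] by (simp_all add: vec_eq_iff forall_3)
      then show ?thesis
        by (auto simp: edge_form_def unit_flex_def axis_def)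
    qed
    then have "cyl_trivial V q ?y"
      using assms(1) by (simp add: cyl_rigid_def cyl_flex_def)
    then obtain c b where "\<forall>v\<in>V. ?y v = c *\<^sub>R quarter_turn (q v) + b"
      by (auto simp: cyl_trivial_def)
    then have "?y v0 = ?y v1"
      using v0 v1 same[of v0 v1] by simp
    then show False
      using v1 by (simp add: unit_flex_def axis_eq_0_iff)
  qed
  then show ?thesis
    using that by (metis vec_eq_iff)
qed

lemma cyl_rigid_card_le:
  assumes "cyl_rigid V E q" and "finite V" and "2 \<le> card V" and "E \<subseteq> complete_edges V"
  shows "3 * card V \<le> card E + 4"
proof -
  obtain v0 v1 k where "v0 \<in> V" "v1 \<in> V" "quarter_turn (q v1) $ k \<noteq> quarter_turn (q v0) $ k"
    using cyl_rigid_imp_turn_differs assms by metis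
  then interpret pinned_placement V E q v0 v1 k
    using assms by unfold_locales auto
  show ?thesis using assms(1) by (rule cyl_rigid_card_lower)
qed

lemma minimally_cyl_rigid_card:
  assumes "cyl_rigid V E q" and "finite V" and "2 \<le> card V" and "E \<subseteq> complete_edges V"
    and minimal: "\<And>e. e \<in> E \<Longrightarrow> \<not> cyl_rigid V (E - {e}) q"
  shows "card E + 4 = 3 * card V"
proof -
  obtain v0 v1 k where "v0 \<in> V" "v1 \<in> V" "quarter_turn (q v1) $ k \<noteq> quarter_turn (q v0) $ k"
    using cyl_rigid_imp_turn_differs assms by metis
  then interpret pinned_placement V E q v0 v1 k
    using assms by unfold_locales auto
  have "\<not> 3 * card V < card E + 4"
  proof
    assume "3 * card V < card E + 4"
    then obtain e where "e \<in> E" "\<And>y. cyl_flex (E - {e}) q y \<Longrightarrow> cyl_flex E q y"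
      using redundant_edge by blast
    then show False
      using minimal[of e] assms(1) by (auto simp: cyl_rigid_def)
  qed
  then show ?thesis using cyl_rigid_card_lower[OF assms(1)] by linarith
qed

section \<open>Infinitesimal isometries of the cylindrical norm\<close>

text \<open>Every point forms a steep pair with all points high enough on the vertical axis, so such pairs make the third coordinate
  of \<open>\<eta>\<close> constant. For the horizontal part, subtract from \<open>\<eta>\<close> the translation and the rotation that it
  suggests at the origin and at the first unit vector. The difference \<open>r\<close> vanishes on the plane of
  height zero by the planar equations against three non-collinear points, and then everywhere, since each
  point \<open>a\<close> has flat pairs, in two independent horizontal directions, with points of that plane.\<close>

lemma infinitesimal_isometry_form:
  fixes \<eta> :: "real ^ 3 \<Rightarrow> real ^ 3"
  assumes iso: "\<And>a b. off_cone (a - b) \<Longrightarrow> edge_form (a - b) (\<eta> a - \<eta> b) = 0"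
  shows "\<exists>c b. \<forall>a. \<eta> a = c *\<^sub>R quarter_turn a + b"
proof -
  have height: "\<eta> a $ 3 = \<eta> b $ 3" if "(a $ 1 - b $ 1)\<^sup>2 + (a $ 2 - b $ 2)\<^sup>2 < (a $ 3 - b $ 3)\<^sup>2" for a b
  proof -
    have "a $ 3 \<noteq> b $ 3" using that by (auto simp: not_sum_power2_lt_zero)
    then show ?thesis using iso[of a b] that by (auto simp: off_cone_def edge_form_def)
  qed
  have flat: "(a $ 1 - b $ 1) * (\<eta> a $ 1 - \<eta> b $ 1) + (a $ 2 - b $ 2) * (\<eta> a $ 2 - \<eta> b $ 2) = 0"
    if "(a $ 3 - b $ 3)\<^sup>2 < (a $ 1 - b $ 1)\<^sup>2 + (a $ 2 - b $ 2)\<^sup>2" for a b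
    using iso[of a b] that by (auto simp: off_cone_def edge_form_def)
  have height_const: "\<eta> a $ 3 = \<eta> 0 $ 3" for a
  proof -
    define h where "h = \<bar>a $ 1\<bar> + \<bar>a $ 2\<bar> + \<bar>a $ 3\<bar> + 1"
    define w :: "real ^ 3" where "w = vector [0, 0, h]"
    have "(a $ 1)\<^sup>2 + (a $ 2)\<^sup>2 \<le> (\<bar>a $ 1\<bar> + \<bar>a $ 2\<bar>)\<^sup>2"
      by (simp add: power2_sum)
    also have "\<dots> < (h - a $ 3)\<^sup>2"
      by (intro power_strict_mono) (auto simp: h_def)
    finally have "\<eta> w $ 3 = \<eta> a $ 3"
      by (intro height) (simp add: w_def)
    moreover have "\<eta> w $ 3 = \<eta> 0 $ 3"
    proof -
      have "h > 0" by (simp add: h_def)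
      then show ?thesis by (intro height) (simp add: w_def)
    qed
    ultimately show ?thesis by simp
  qed
  define pt :: "real \<Rightarrow> real \<Rightarrow> real ^ 3" where "pt s t = vector [s, t, 0]" for s t
  define c where "c = \<eta> (pt 1 0) $ 2 - \<eta> 0 $ 2"
  define r where "r a = \<eta> a - \<eta> 0 - c *\<^sub>R quarter_turn a" for a
  have flat_r: "(a $ 1 - b $ 1) * (r a $ 1 - r b $ 1) + (a $ 2 - b $ 2) * (r a $ 2 - r b $ 2) = 0"
    if "(a $ 3 - b $ 3)\<^sup>2 < (a $ 1 - b $ 1)\<^sup>2 + (a $ 2 - b $ 2)\<^sup>2" for a b
    using flat[OF that] by (simp add: r_def algebra_simps)
  have flat_plane: "(s - s') * (r (pt s t) $ 1 - r (pt s' t') $ 1) + (t - t') * (r (pt s t) $ 2 - r (pt s' t') $ 2) = 0"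
    for s t s' t'
  proof (cases "s = s' \<and> t = t'")
    case False
    then have "0 < (s - s')\<^sup>2 + (t - t')\<^sup>2" by (simp add: sum_power2_gt_zero_iff)
    then show ?thesis using flat_r[of "pt s t" "pt s' t'"] by (simp add: pt_def)
  qed simp
  have pt0: "pt 0 0 = 0" by (simp add: pt_def vec_eq_iff forall_3)
  have r0: "r 0 = 0" by (simp add: r_def linear_0[OF linear_quarter_turn])
  have r1: "r (pt 1 0) $ 1 = 0" "r (pt 1 0) $ 2 = 0"
    using flat_plane[of 1 0 0 0] by (simp_all add: pt0 r0) (simp add: r_def c_def pt_def)
  have r2: "r (pt 0 1) $ 1 = 0" "r (pt 0 1) $ 2 = 0"
    using flat_plane[of 0 0 1 0] flat_plane[of 1 0 0 1] r1 by (simp_all add: pt0 r0)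
  have plane: "r (pt s t) $ 1 = 0 \<and> r (pt s t) $ 2 = 0" for s t
  proof -
    have "s * r (pt s t) $ 1 + t * r (pt s t) $ 2 = 0"
      "(s - 1) * r (pt s t) $ 1 + t * r (pt s t) $ 2 = 0"
      "s * r (pt s t) $ 1 + (t - 1) * r (pt s t) $ 2 = 0"
      using flat_plane[of s 0 t 0] flat_plane[of s 1 t 0] flat_plane[of s 0 t 1] r1 r2
      by (simp_all add: pt0 r0)
    then show ?thesis by (simp add: left_diff_distrib)
  qed
  have "\<eta> a = c *\<^sub>R quarter_turn a + \<eta> 0" for a
  proof -
    \<comment> \<open>Points of the plane at horizontal distance \<open>R\<close> from \<open>a\<close> form flat pairs with \<open>a\<close>.\<close>
    define R where "R = \<bar>a $ 3\<bar> + 1"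
    have R: "(a $ 3)\<^sup>2 < R\<^sup>2" "R \<noteq> 0"
      by (simp_all add: R_def flip: abs_le_square_iff not_le)
    have "R * r a $ 1 = 0"
      using flat_r[of a "pt (a $ 1 + R) (a $ 2)"] R plane[of "a $ 1 + R" "a $ 2"] by (simp add: pt_def)
    moreover have "R * r a $ 2 = 0"
      using flat_r[of a "pt (a $ 1) (a $ 2 + R)"] R plane[of "a $ 1" "a $ 2 + R"] by (simp add: pt_def)
    moreover have "r a $ 3 = 0"
      using height_const by (simp add: r_def)
    ultimately have "r a = 0"
      using R by (simp add: vec_eq_iff forall_3)
    then show ?thesis by (simp add: r_def algebra_simps)
  qed
  then show ?thesis by blast
qed

section \<open>Smoothness, rigid motions and flexes in coordinates\<close>

locale cylindrical_coords =
  fixes T :: "'x::real_normed_vector \<Rightarrow> real ^ 3"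
  assumes linear_T: "linear T" and bij_T: "bij T" and norm_T: "cyl_norm (T x) = norm x"
begin

definition S :: "real ^ 3 \<Rightarrow> 'x" where "S = inv T"

lemma T_S [simp]: "T (S a) = a"
  using bij_T by (simp add: S_def bij_def surj_f_inv_f)

lemma S_T [simp]: "S (T x) = x"
  using bij_T by (simp add: S_def bij_def)

lemma linear_S: "linear S"
proof (rule linearI)
  have inj: "x = y" if "T x = T y" for x y using that by (metis S_T)
  show "S (a + b) = S a + S b" for a b by (rule inj) (simp add: linear_add[OF linear_T])
  show "S (c *\<^sub>R a) = c *\<^sub>R S a" for c a by (rule inj) (simp add: linear_cmul[OF linear_T])
qed

lemma bounded_linear_S: "bounded_linear S"
  using linear_S by (simp add: linear_conv_bounded_linear)

lemma bounded_linear_T: "bounded_linear T"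
proof (rule bounded_linear_intro)
  show "T (x + y) = T x + T y" for x y by (rule linear_add[OF linear_T])
  show "T (c *\<^sub>R x) = c *\<^sub>R T x" for c x by (rule linear_cmul[OF linear_T])
  show "norm (T x) \<le> norm x * 3" for x
  proof -
    have "\<bar>T x $ 1\<bar> \<le> norm x" "\<bar>T x $ 2\<bar> \<le> norm x" "\<bar>T x $ 3\<bar> \<le> norm x"
      unfolding norm_T[symmetric] cyl_norm_def
      by (auto simp: le_max_iff_disj intro: real_le_rsqrt simp flip: real_sqrt_abs)
    then show ?thesis
      using norm_le_l1_cart[of "T x"] by (simp add: sum_3)
  qed
qed

lemma norm_curve_derivative:
  assumes "(\<gamma> has_vector_derivative u) (at 0)" and "off_cone (T (\<gamma> 0))"
  shows "((\<lambda>t. norm (\<gamma> t)) has_real_derivative edge_form (T (\<gamma> 0)) (T u) / norm (\<gamma> 0)) (at 0)"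
  using cyl_norm_curve_derivative[of "\<lambda>t. T (\<gamma> t)" "T u"]
    bounded_linear.has_vector_derivative[OF bounded_linear_T assms(1)] assms(2)
  by (simp add: norm_T)

lemma norm_line_derivative:
  assumes "off_cone (T x)"
  shows "((\<lambda>t. norm (x + t *\<^sub>R u)) has_real_derivative edge_form (T x) (T u) / norm x) (at 0)"
proof -
  have "((\<lambda>t. x + t *\<^sub>R u) has_vector_derivative u) (at 0)"
    by (auto intro!: derivative_eq_intros)
  then show ?thesis
    using norm_curve_derivative[of "\<lambda>t. x + t *\<^sub>R u" u] assms by simp
qed

lemma support_functional_horizontal:
  assumes "norm x = 1" and "(T x $ 1)\<^sup>2 + (T x $ 2)\<^sup>2 = 1"
  shows "support_functional x (\<lambda>u. T x $ 1 * T u $ 1 + T x $ 2 * T u $ 2)"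
proof -
  let ?f = "\<lambda>u. T x $ 1 * T u $ 1 + T x $ 2 * T u $ 2"
  have bound: "norm (?f u) \<le> 1 * norm u" for u
  proof -
    have "(?f u)\<^sup>2 \<le> ((T x $ 1)\<^sup>2 + (T x $ 2)\<^sup>2) * ((T u $ 1)\<^sup>2 + (T u $ 2)\<^sup>2)"
      using zero_le_power2[of "T x $ 1 * T u $ 2 - T x $ 2 * T u $ 1"]
      by (simp add: power2_eq_square algebra_simps)
    then have "\<bar>?f u\<bar> \<le> sqrt ((T u $ 1)\<^sup>2 + (T u $ 2)\<^sup>2)"
      using assms(2) by (simp add: real_le_rsqrt)
    then show ?thesis
      unfolding norm_T[symmetric] cyl_norm_def by simp
  qed
  then have "bounded_linear ?f"
    by (intro bounded_linear_intro[where K = 1])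
      (simp_all add: linear_add[OF linear_T] linear_cmul[OF linear_T] algebra_simps)
  moreover have "onorm ?f \<le> 1"
    using bound by (intro onorm_bound) auto
  ultimately show ?thesis
    using assms(2) by (simp add: support_functional_def power2_eq_square)
qed

lemma support_functional_vertical:
  assumes "norm x = 1" and "(T x $ 3)\<^sup>2 = 1"
  shows "support_functional x (\<lambda>u. T x $ 3 * T u $ 3)"
proof -
  let ?f = "\<lambda>u. T x $ 3 * T u $ 3"
  have "\<bar>T x $ 3\<bar> = 1" using assms(2) by (auto simp: power2_eq_1_iff)
  then have bound: "norm (?f u) \<le> 1 * norm u" for u
    unfolding norm_T[symmetric] cyl_norm_def by (simp add: abs_mult)
  then have "bounded_linear ?f"
    by (intro bounded_linear_intro[where K = 1])
      (simp_all add: linear_add[OF linear_T] linear_cmul[OF linear_T] algebra_simps)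
  moreover have "onorm ?f \<le> 1"
    using bound by (intro onorm_bound) auto
  ultimately show ?thesis
    using assms(2) by (simp add: support_functional_def power2_eq_square)
qed

lemma max_squares_unit:
  assumes "norm x = 1"
  shows "max ((T x $ 1)\<^sup>2 + (T x $ 2)\<^sup>2) ((T x $ 3)\<^sup>2) = 1"
  using norm_T[of x] assms by (simp add: cyl_norm_eq)

text \<open>A support functional stays below the norm and touches it at \<open>x\<close>, so along each line through \<open>x\<close>
  it has the same derivative at \<open>x\<close> as the norm.\<close>

lemma support_functional_unique:
  assumes f: "support_functional x f" and "norm x = 1" and "off_cone (T x)"
  shows "f u = edge_form (T x) (T u)"
proof -
  have lin: "bounded_linear f" and fx: "f x = 1"
    using f by (auto simp: support_functional_def)
  have le: "f y \<le> norm y" for y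
  proof -
    have "\<bar>f y\<bar> \<le> onorm f * norm y" using onorm[OF lin, of y] by simp
    also have "\<dots> \<le> 1 * norm y"
      using f by (intro mult_right_mono) (auto simp: support_functional_def)
    finally show ?thesis by simp
  qed
  have "((\<lambda>t. norm (x + t *\<^sub>R u)) has_real_derivative edge_form (T x) (T u)) (at 0)"
    using norm_line_derivative[OF assms(3)] assms(2) by simp
  then have "((\<lambda>t. norm (x + t *\<^sub>R u) - (1 + t * f u)) has_real_derivative edge_form (T x) (T u) - f u) (at 0)"
    by (auto intro!: derivative_eq_intros)
  moreover have "norm (x + 0 *\<^sub>R u) - (1 + 0 * f u) \<le> norm (x + t *\<^sub>R u) - (1 + t * f u)" for t
    using le[of "x + t *\<^sub>R u"] assms(2) fx lin
    by (simp add: bounded_linear.linear linear_add linear_cmul)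
  ultimately show ?thesis
    using DERIV_local_min[of "\<lambda>t. norm (x + t *\<^sub>R u) - (1 + t * f u)" _ 0 1] by fastforce
qed

text \<open>On the cone, the horizontal and the vertical support functional both exist and differ; off the
  cone, one of them exists and differentiability makes it unique. At \<open>0\<close>, which lies on the cone, the norm is not
  smooth by definition.\<close>

lemma norm_smooth_at_iff: "norm_smooth_at x \<longleftrightarrow> off_cone (T x)"
proof (cases "x = 0")
  case True
  then show ?thesis
    by (simp add: norm_smooth_at_def off_cone_def linear_0[OF linear_T])
next
  case False
  define w where "w = x /\<^sub>R norm x"
  have w: "norm w = 1" using False by (simp add: w_def)
  have "off_cone (T x) \<longleftrightarrow> off_cone (T w)"
    using False by (simp add: w_def off_cone_def linear_cmul[OF linear_T] power_mult_distrib flip: distrib_left)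
  also have "\<dots> \<longleftrightarrow> (\<exists>!f. support_functional w f)"
  proof
    assume off: "off_cone (T w)"
    have "support_functional w (\<lambda>u. edge_form (T w) (T u))"
      using max_squares_unit[OF w] off support_functional_horizontal[OF w] support_functional_vertical[OF w]
      by (auto simp: edge_form_def off_cone_def max_def split: if_splits)
    then show "\<exists>!f. support_functional w f"
      using support_functional_unique[OF _ w off] by (intro ex1I) (auto simp: fun_eq_iff)
  next
    assume uniq: "\<exists>!f. support_functional w f"
    show "off_cone (T w)"
    proof (rule ccontr)
      assume "\<not> ?thesis"
      then have *: "(T w $ 1)\<^sup>2 + (T w $ 2)\<^sup>2 = 1" "(T w $ 3)\<^sup>2 = 1"
        using max_squares_unit[OF w] by (simp_all add: off_cone_def)
      have "(\<lambda>u. T w $ 1 * T u $ 1 + T w $ 2 * T u $ 2) = (\<lambda>u. T w $ 3 * T u $ 3)"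
        using uniq support_functional_horizontal[OF w *(1)] support_functional_vertical[OF w *(2)] by blast
      from fun_cong[OF this, of "S (axis 3 1)"] have "T w $ 3 = 0"
        by (simp add: axis_def)
      then show False using * by simp
    qed
  qed
  finally show ?thesis
    using False by (simp add: norm_smooth_at_def w_def)
qed

text \<open>Differentiating the constant distance between two moving points at time \<open>0\<close> gives the hypothesis of
  \<open>infinitesimal_isometry_form\<close> for the velocities.\<close>

lemma infinitesimal_rigid_motionsD:
  assumes "\<eta> \<in> infinitesimal_rigid_motions"
  shows "\<exists>c b. \<forall>x. T (\<eta> x) = c *\<^sub>R quarter_turn (T x) + b"
proof -
  obtain \<alpha> where \<alpha>: "rigid_motion \<alpha>" "\<And>x. (\<alpha> x has_vector_derivative \<eta> x) (at 0)"
    using assms by (auto simp: infinitesimal_rigid_motions_def)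
  have "edge_form (a - b) (T (\<eta> (S a)) - T (\<eta> (S b))) = 0" if off: "off_cone (a - b)" for a b
  proof -
    let ?\<gamma> = "\<lambda>t. \<alpha> (S a) t - \<alpha> (S b) t"
    have start: "?\<gamma> 0 = S a - S b" and const: "\<And>t. t \<in> {-1..1} \<Longrightarrow> norm (?\<gamma> t) = norm (S a - S b)"
      using \<alpha>(1) by (auto simp: rigid_motion_def)
    have T\<gamma>: "T (?\<gamma> 0) = a - b"
      unfolding start by (simp add: linear_diff[OF linear_T])
    have "(?\<gamma> has_vector_derivative \<eta> (S a) - \<eta> (S b)) (at 0)"
      by (intro derivative_intros \<alpha>)
    then have "((\<lambda>t. norm (?\<gamma> t)) has_real_derivative
        edge_form (a - b) (T (\<eta> (S a) - \<eta> (S b))) / norm (S a - S b)) (at 0)"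
      using norm_curve_derivative[of ?\<gamma>] off T\<gamma> start by metis
    moreover have "((\<lambda>t. norm (?\<gamma> t)) has_real_derivative 0) (at 0)"
      by (rule has_field_derivative_transform_within_open[OF DERIV_const[of "norm (S a - S b)"],
            where S = "{-1<..<1}"]) (auto simp: const)
    ultimately have "edge_form (a - b) (T (\<eta> (S a) - \<eta> (S b))) / norm (S a - S b) = 0"
      using DERIV_unique by blast
    moreover have "S a - S b \<noteq> 0"
    proof
      assume "S a - S b = 0"
      then have "a - b = 0" by (metis T_S right_minus_eq)
      then show False using off by (simp add: off_cone_def)
    qed
    ultimately show ?thesis by (simp add: linear_diff[OF linear_T])
  qed
  from infinitesimal_isometry_form[of "\<lambda>a. T (\<eta> (S a))", OF this]
  obtain c b where "\<And>a. T (\<eta> (S a)) = c *\<^sub>R quarter_turn a + b" by blast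
  then show ?thesis by (metis S_T)
qed

text \<open>The motion rotates about the vertical axis with angular speed \<open>c\<close> and translates with velocity
  \<open>b\<close>. The rotation is written by Rodrigues' formula, in terms of \<^const>\<open>quarter_turn\<close>, so that its
  derivative at \<open>0\<close> can be read off.\<close>

lemma infinitesimal_rigid_motionsI:
  "(\<lambda>x. S (c *\<^sub>R quarter_turn (T x) + b)) \<in> infinitesimal_rigid_motions"
proof -
  define rot where "rot t a = a + sin t *\<^sub>R quarter_turn a + (1 - cos t) *\<^sub>R quarter_turn (quarter_turn a)" for t a
  have lin_rot: "rot t (a - a') = rot t a - rot t a'" for t a a'
    by (simp add: rot_def linear_diff[OF linear_quarter_turn] algebra_simps)
  have norm_rot: "cyl_norm (rot t a) = cyl_norm a" for t a
  proof -
    have "(rot t a $ 1)\<^sup>2 + (rot t a $ 2)\<^sup>2 = ((sin t)\<^sup>2 + (cos t)\<^sup>2) * ((a $ 1)\<^sup>2 + (a $ 2)\<^sup>2)"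
      unfolding rot_def by (simp add: power2_eq_square algebra_simps del: sin_cos_squared_add sin_cos_squared_add2 sin_cos_squared_add3)
    then have "(rot t a $ 1)\<^sup>2 + (rot t a $ 2)\<^sup>2 = (a $ 1)\<^sup>2 + (a $ 2)\<^sup>2"
      by simp
    then show ?thesis
      unfolding cyl_norm_def by (simp add: rot_def)
  qed
  define \<alpha> where "\<alpha> x t = S (rot (c * t) (T x) + t *\<^sub>R b)" for x t
  have deriv: "(\<alpha> x has_vector_derivative S (c *\<^sub>R quarter_turn (T x) + b)) (at 0)" for x
    unfolding \<alpha>_def rot_def
    by (rule bounded_linear.has_vector_derivative[OF bounded_linear_S])
      (auto intro!: derivative_eq_intros simp: has_real_derivative_iff_has_vector_derivative[symmetric])
  have "rigid_motion \<alpha>"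
    unfolding rigid_motion_def
  proof (intro conjI allI ballI)
    show "continuous_on {-1..1} (\<alpha> x)" for x
      unfolding \<alpha>_def rot_def
      by (intro continuous_intros bounded_linear.continuous_on[OF bounded_linear_S])
    show "\<alpha> x 0 = x" for x by (simp add: \<alpha>_def rot_def)
    show "\<alpha> x differentiable at 0" for x
      using deriv[of x] unfolding has_vector_derivative_def differentiable_def by blast
    show "norm (\<alpha> x t - \<alpha> y t) = norm (x - y)" for x y t
    proof -
      have "\<alpha> x t - \<alpha> y t = S (rot (c * t) (T (x - y)))"
        by (simp add: \<alpha>_def lin_rot linear_diff[OF linear_T] flip: linear_diff[OF linear_S])
      then show ?thesis by (simp add: norm_rot flip: norm_T)
    qed
  qed
  then show ?thesis using deriv by (auto simp: infinitesimal_rigid_motions_def)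
qed

lemma well_positioned_iff:
  "well_positioned E p \<longleftrightarrow> (\<forall>v w. {v, w} \<in> E \<longrightarrow> off_cone (T (p v) - T (p w)))"
  by (simp add: well_positioned_def norm_smooth_at_iff linear_diff[OF linear_T])

lemma infinitesimal_flex_iff:
  assumes "well_positioned E p"
  shows "infinitesimal_flex E p z \<longleftrightarrow> cyl_flex E (T \<circ> p) (T \<circ> z)"
proof -
  have "((\<lambda>t::real. (norm ((p v + t *\<^sub>R z v) - (p w + t *\<^sub>R z w)) - norm (p v - p w)) / t) \<longlongrightarrow> 0) (at 0)
      \<longleftrightarrow> edge_form (T (p v) - T (p w)) (T (z v) - T (z w)) = 0" if "{v, w} \<in> E" for v w
  proof -
    let ?lim = "\<lambda>L. ((\<lambda>t::real. (norm ((p v + t *\<^sub>R z v) - (p w + t *\<^sub>R z w)) - norm (p v - p w)) / t) \<longlongrightarrow> L) (at 0)"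
    let ?D = "edge_form (T (p v) - T (p w)) (T (z v) - T (z w)) / norm (p v - p w)"
    have smooth: "norm_smooth_at (p v - p w)"
      using assms that by (auto simp: well_positioned_def)
    have eq: "p v + t *\<^sub>R z v - (p w + t *\<^sub>R z w) = p v - p w + t *\<^sub>R (z v - z w)" for t
      by (simp add: algebra_simps)
    have "((\<lambda>t. norm (p v - p w + t *\<^sub>R (z v - z w))) has_real_derivative ?D) (at 0)"
      using norm_line_derivative[of "p v - p w" "z v - z w"] smooth
      by (simp add: norm_smooth_at_iff linear_diff[OF linear_T])
    then have lim: "?lim ?D"
      by (simp add: DERIV_def eq)
    have "?lim 0 \<longleftrightarrow> ?D = 0"
      using lim tendsto_unique[OF _ lim] by fastforce
    then show ?thesis
      using smooth by (auto simp: norm_smooth_at_def)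
  qed
  then show ?thesis
    by (auto simp: infinitesimal_flex_def cyl_flex_def)
qed

lemma trivial_flex_iff: "trivial_flex V p z \<longleftrightarrow> cyl_trivial V (T \<circ> p) (T \<circ> z)"
proof
  assume "trivial_flex V p z"
  then obtain \<eta> where "\<eta> \<in> infinitesimal_rigid_motions" "\<forall>v\<in>V. z v = \<eta> (p v)"
    by (auto simp: trivial_flex_def)
  then show "cyl_trivial V (T \<circ> p) (T \<circ> z)"
    using infinitesimal_rigid_motionsD[of \<eta>] by (fastforce simp: cyl_trivial_def)
next
  assume "cyl_trivial V (T \<circ> p) (T \<circ> z)"
  then obtain c b where "\<forall>v\<in>V. T (z v) = c *\<^sub>R quarter_turn (T (p v)) + b"
    by (auto simp: cyl_trivial_def)
  then have "\<forall>v\<in>V. z v = S (c *\<^sub>R quarter_turn (T (p v)) + b)"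
    by (metis S_T)
  then show "trivial_flex V p z"
    unfolding trivial_flex_def by (intro bexI[OF _ infinitesimal_rigid_motionsI[of c b]]) simp
qed

lemma infinitesimally_rigid_iff:
  assumes "well_positioned E p"
  shows "infinitesimally_rigid V E p \<longleftrightarrow> cyl_rigid V E (T \<circ> p)"
proof -
  have "T \<circ> (S \<circ> y) = y" for y :: "'v \<Rightarrow> real ^ 3" by auto
  then show ?thesis
    unfolding infinitesimally_rigid_def cyl_rigid_def infinitesimal_flex_iff[OF assms] trivial_flex_iff
    by metis
qed

lemma minimally_infinitesimally_rigid_iff:
  assumes "well_positioned E p"
  shows "minimally_infinitesimally_rigid V E p \<longleftrightarrow>
    cyl_rigid V E (T \<circ> p) \<and> (\<forall>e\<in>E. \<not> cyl_rigid V (E - {e}) (T \<circ> p))"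
proof -
  have "well_positioned (E - {e}) p" for e
    using assms by (simp add: well_positioned_def)
  then show ?thesis
    using assms by (simp add: minimally_infinitesimally_rigid_def infinitesimally_rigid_iff)
qed

end

section \<open>Edge counts and a rigid placement of the complete graph minus an edge\<close>

lemma card_complete_edges: "finite V \<Longrightarrow> card (complete_edges V) = card V choose 2"
  unfolding complete_edges_def by (rule n_subsets)

lemma finite_complete_edges: "finite V \<Longrightarrow> finite (complete_edges V)"
  by (rule finite_subset[of _ "Pow V"]) (auto simp: complete_edges_def)

text \<open>With \<open>n\<close> vertices, \<open>n (n - 1) / 2\<close> is less than \<open>3 n - 4\<close> for \<open>n\<close> from \<open>2\<close> to \<open>5\<close>, and equals \<open>15 = 14 + 1\<close> for
  \<open>n = 6\<close>.\<close>

lemma edge_count_imp_K6_minus_edge: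
  assumes "finite V" "2 \<le> card V" "card V \<le> 6" "E \<subseteq> complete_edges V" "card E + 4 = 3 * card V"
  shows "K6_minus_edge V E"
proof -
  have le: "card E \<le> card V choose 2"
    using card_mono[OF finite_complete_edges assms(4)] assms(1) by (simp add: card_complete_edges)
  have "card V \<in> {2, 3, 4, 5, 6}"
    using assms(2,3) by auto
  then have V: "card V = 6"
    using le assms(5) by (auto simp: choose_two)
  have "card (complete_edges V) = 15"
    using assms(1) V by (simp add: card_complete_edges choose_two)
  then have "card (complete_edges V - E) = 1"
    using assms V card_Diff_subset[OF finite_subset[OF assms(4)] assms(4)] by (simp add: finite_complete_edges)
  then obtain e where "complete_edges V - E = {e}"
    by (auto simp: card_1_singleton_iff)
  then have "e \<in> complete_edges V" "E = complete_edges V - {e}"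
    using assms(4) by auto
  then show ?thesis
    using assms(1) V by (auto simp: K6_minus_edge_def)
qed

text \<open>The joints \<open>a, b, c, d, g, f\<close> alternate between heights \<open>0\<close> and \<open>2\<close>, while consecutive ones are at
  horizontal distance less than \<open>2\<close>. So exactly the edges of this path are steep, and they force equal
  heights. All other edges are flat and form the prism with triangles \<open>a c g\<close> and \<open>b d f\<close> and
  rungs \<open>a d\<close>, \<open>b g\<close>, \<open>c f\<close>. The slopes along the rungs are \<open>1/3\<close>, \<open>1/3\<close> and \<open>0\<close>, so their lines are neither
  concurrent nor all parallel, which makes this prism rigid in the plane.\<close>

lemma zigzag_placement:
  assumes "K6_minus_edge V E"
  obtains q where "\<And>v w. {v, w} \<in> E \<Longrightarrow> off_cone (q v - q w)" "cyl_rigid V E q"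
proof -
  obtain e where e: "e \<in> complete_edges V" "E = complete_edges V - {e}" and V: "finite V" "card V = 6"
    using assms by (auto simp: K6_minus_edge_def)
  obtain a f where af: "e = {a, f}" "a \<noteq> f" "a \<in> V" "f \<in> V"
    using e(1) by (auto simp: complete_edges_def card_2_iff)
  have "card (V - {a, f}) = 4"
    using V af by (simp add: card_Diff_subset)
  then obtain b c d g where rest: "V - {a, f} = {b, c, d, g}" and "distinct [b, c, d, g]"
    by (auto simp: numeral_eq_Suc card_Suc_eq)
  moreover have "V = {a, b, c, d, g, f}"
    using rest af by auto
  ultimately have dist: "distinct [a, b, c, d, g, f]" and Veq: "V = {a, b, c, d, g, f}"
    using af by auto
  have "distinct [f, g, d, c, b, a]"
    using dist by auto
  note neq = dist[simplified] this[simplified]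
  have E: "{v, w} \<in> E \<longleftrightarrow> v \<in> V \<and> w \<in> V \<and> v \<noteq> w \<and> {v, w} \<noteq> {a, f}" for v w
    by (auto simp: e(2) af(1) complete_edges_def card_2_iff doubleton_eq_iff)
  define q :: "'a \<Rightarrow> real ^ 3" where
    "q v = (if v = a then vector [0, 0, 0] else if v = b then vector [1, 0, 2]
      else if v = c then vector [2, 1, 0] else if v = d then vector [3, 1, 2]
      else if v = g then vector [4, 1, 0] else vector [5, 1, 2])" for v
  have q: "q a = vector [0, 0, 0]" "q b = vector [1, 0, 2]" "q c = vector [2, 1, 0]"
    "q d = vector [3, 1, 2]" "q g = vector [4, 1, 0]" "q f = vector [5, 1, 2]"
    using dist by (auto simp: q_def)
  have "off_cone (q v - q w)" if "{v, w} \<in> E" for v w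
  proof -
    have "v \<in> {a, b, c, d, g, f}" "w \<in> {a, b, c, d, g, f}" "v \<noteq> w"
      using that E[of v w] Veq by auto
    then show ?thesis
      by (auto simp: q off_cone_def)
  qed
  moreover have "cyl_rigid V E q"
    unfolding cyl_rigid_def
  proof (intro allI impI)
    fix y assume y: "cyl_flex E q y"
    have edge: "edge_form (q v - q w) (y v - y w) = 0" if "{v, w} \<in> E" for v w
      using y that by (simp add: cyl_flex_def)
    have steep: "y b $ 3 = y a $ 3" "y c $ 3 = y b $ 3" "y d $ 3 = y c $ 3" "y g $ 3 = y d $ 3" "y f $ 3 = y g $ 3"
      using edge[of b a] edge[of c b] edge[of d c] edge[of g d] edge[of f g]
      by (simp_all add: E Veq q edge_form_def doubleton_eq_iff neq)
    have flat: "2 * (y c $ 1 - y a $ 1) + (y c $ 2 - y a $ 2) = 0"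
      "4 * (y g $ 1 - y a $ 1) + (y g $ 2 - y a $ 2) = 0"
      "2 * (y g $ 1 - y c $ 1) = 0"
      "2 * (y d $ 1 - y b $ 1) + (y d $ 2 - y b $ 2) = 0"
      "4 * (y f $ 1 - y b $ 1) + (y f $ 2 - y b $ 2) = 0"
      "2 * (y f $ 1 - y d $ 1) = 0"
      "3 * (y d $ 1 - y a $ 1) + (y d $ 2 - y a $ 2) = 0"
      "3 * (y g $ 1 - y b $ 1) + (y g $ 2 - y b $ 2) = 0"
      "3 * (y f $ 1 - y c $ 1) = 0"
      using edge[of c a] edge[of g a] edge[of g c] edge[of d b] edge[of f b] edge[of f d]
        edge[of d a] edge[of g b] edge[of f c]
      by (simp_all add: E Veq q edge_form_def doubleton_eq_iff neq)
    \<comment> \<open>The first path edge has horizontal direction \<open>(1, 0)\<close>, so the second coordinate shows the speed of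
      rotation; the first path joint sits at the origin, so its velocity is the translation.\<close>
    define r where "r = y b $ 2 - y a $ 2"
    have "y v = r *\<^sub>R quarter_turn (q v) + y a" if "v \<in> V" for v
    proof -
      have "y b $ 1 = y a $ 1"
        using flat by argo
      moreover have "y c $ 1 = y a $ 1 - r" "y c $ 2 = y a $ 2 + 2 * r"
        "y d $ 1 = y a $ 1 - r" "y d $ 2 = y a $ 2 + 3 * r"
        "y g $ 1 = y a $ 1 - r" "y g $ 2 = y a $ 2 + 4 * r"
        "y f $ 1 = y a $ 1 - r" "y f $ 2 = y a $ 2 + 5 * r"
        using flat unfolding r_def by argo+
      ultimately show ?thesis
        using that steep by (auto simp: Veq q vec_eq_iff forall_3 r_def)
    qed
    then show "cyl_trivial V q y"
      unfolding cyl_trivial_def by blast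
  qed
  ultimately show ?thesis using that by blast
qed

theorem theorem5p5:
  assumes "cylindrical_normed_space TYPE('x::real_normed_vector)"
  shows
    "(\<forall>(V :: 'v set) E (p :: 'v \<Rightarrow> 'x).
        card V \<ge> 2 \<and> framework V E p \<and> well_positioned E p \<and>
        minimally_infinitesimally_rigid V E p \<longrightarrow>
        K6_minus_edge V E \<or> card V \<ge> 7) \<and>
     (\<forall>(V :: 'v set) E. K6_minus_edge V E \<longrightarrow>
        (\<exists>p :: 'v \<Rightarrow> 'x. framework V E p \<and> well_positioned E p \<and>
           minimally_infinitesimally_rigid V E p))"
proof -
  obtain T :: "'x \<Rightarrow> real ^ 3" where T: "linear T" "bij T" "\<And>x. cyl_norm (T x) = norm x"
    using assms by (auto simp: cylindrical_normed_space_def)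
  then interpret cylindrical_coords T
    by (rule cylindrical_coords.intro)
  show ?thesis
  proof (intro conjI allI impI)
    fix V :: "'v set" and E and p :: "'v \<Rightarrow> 'x"
    assume *: "card V \<ge> 2 \<and> framework V E p \<and> well_positioned E p \<and> minimally_infinitesimally_rigid V E p"
    then have V: "finite V" "E \<subseteq> complete_edges V"
      by (auto simp: framework_def finite_simple_graph_def)
    have "card E + 4 = 3 * card V"
      using * V minimally_infinitesimally_rigid_iff[of E p V]
      by (intro minimally_cyl_rigid_card[of V E "T \<circ> p"]) auto
    then show "K6_minus_edge V E \<or> card V \<ge> 7"
      using edge_count_imp_K6_minus_edge[of V E] V * by linarith
  next
    fix V :: "'v set" and E
    assume K: "K6_minus_edge V E"
    then have V: "finite V" "card V = 6" and E: "E \<subseteq> complete_edges V" and cE: "card E = 14"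
      by (auto simp: K6_minus_edge_def card_complete_edges finite_complete_edges choose_two)
    obtain q :: "'v \<Rightarrow> real ^ 3" where off: "\<And>v w. {v, w} \<in> E \<Longrightarrow> off_cone (q v - q w)" and rigid: "cyl_rigid V E q"
      using zigzag_placement[OF K] by blast
    define p where "p = S \<circ> q"
    have Tp: "T \<circ> p = q" by (auto simp: p_def)
    have "well_positioned E p"
      using off by (simp add: well_positioned_iff p_def)
    moreover have "framework V E p"
      using V E \<open>well_positioned E p\<close>
      by (auto simp: framework_def finite_simple_graph_def well_positioned_def norm_smooth_at_def)
    moreover have "\<not> cyl_rigid V (E - {e}) q" if "e \<in> E" for e
    proof
      assume "cyl_rigid V (E - {e}) q"
      then have "3 * card V \<le> card (E - {e}) + 4"
        using V E by (intro cyl_rigid_card_le) auto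
      then show False using V cE that by simp
    qed
    ultimately show "\<exists>p :: 'v \<Rightarrow> 'x. framework V E p \<and> well_positioned E p \<and> minimally_infinitesimally_rigid V E p"
      using rigid by (auto simp: minimally_infinitesimally_rigid_iff Tp)
  qed
qed

end
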